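(* Let $\chi_1,\chi_2,\dots$ be i.i.d. random variables uniformly distributed on $(0,1)$, let $S_0=0$ and $S_i=\sum_{j=1}^i\chi_j$ for $i\ge1$, and for $t\ge0$ let $N(t)=\min\{i\in\mathbb Z_+:S_i>t\}$ be the counting function of the uniform renewal process. Then, with $\alpha_1\approx-2.0888$ the real part of the root $\alpha_1+\beta_1i=-(2.088843\dots)+(7.461489\dots)i$ of $\lambda-1+e^{-\lambda}=0$, as $t\to\infty$, $$\mathbb E[N(t)^2]=4t^2+\tfrac{10}{3}t+\tfrac23+O(te^{\alpha_1t});\qquad \operatorname{Var}[N(t)]=\tfrac23t+\tfrac29+O(te^{\alpha_1t}).$$
   Context: $\mathbb Z_+=\{0,1,2,\dots\}$. The counting function $N(t)$ counts the renewal at time $0$: $N(t)=1+\max\{i\in\mathbb Z_+:S_i\le t\}$. The nonzero roots of $\lambda-1+e^{-\lambda}=0$ occur in complex conjugate pairs, and $\alpha_1$ is the largest real part among them. *)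

theory Defs
  imports "HOL-Probability.Probability" "HOL-Library.Landau_Symbols"
begin

text \<open>The increments are indexed from 1; the value of \<open>X 0\<close> is never used.\<close>

definition renewal_sum :: "(nat \<Rightarrow> 'a \<Rightarrow> real) \<Rightarrow> nat \<Rightarrow> 'a \<Rightarrow> real" where
  "renewal_sum X i \<omega> = (\<Sum>j=1..i. X j \<omega>)"

text \<open>The minimum exists almost surely; on the exceptional null set the value is unspecified.\<close>

definition renewal_count :: "(nat \<Rightarrow> 'a \<Rightarrow> real) \<Rightarrow> real \<Rightarrow> 'a \<Rightarrow> nat" where
  "renewal_count X t \<omega> = (LEAST i. renewal_sum X i \<omega> > t)"

definition char_root :: "complex \<Rightarrow> bool" where
  "char_root z \<longleftrightarrow> z - 1 + exp (- z) = 0"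

text \<open>\<open>Max\<close> is not applicable here because there are infinitely many roots.\<close>

definition alpha1 :: real where
  "alpha1 = (GREATEST a. \<exists>z. z \<noteq> 0 \<and> char_root z \<and> Re z = a)"

end

theory Submission
  imports Defs "HOL-Real_Asymp.Real_Asymp" "HOL-Complex_Analysis.Complex_Analysis"
begin

text \<open>
  Almost surely \<open>N(t) > n\<close> iff \<open>S\<^sub>n \<le> t\<close>, so \<open>E N = \<Sum>\<^sub>n P(S\<^sub>n \<le> t)\<close> and
  \<open>E N\<^sup>2 = \<Sum>\<^sub>n (2n + 1) P(S\<^sub>n \<le> t)\<close>. Inserting the Irwin--Hall formula for \<open>P(S\<^sub>n \<le> t)\<close> and
  summing over \<open>n\<close> first gives \<open>E N = U(t) = \<Sum>\<^sub>k (-1)\<^sup>k (t-k)\<^sup>k e\<^bsup>t-k\<^esup> / k!\<close> (over \<open>k \<le> t\<close>) and,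
  with the same computation, \<open>E N\<^sup>2 = (2t + 1) U(t)\<close>. Hence everything follows from
  \<open>U(t) = 2t + 2/3 + O(e\<^bsup>alpha1 t\<^esup>)\<close>.

  For fixed \<open>s\<close> in \<open>[0, 1)\<close> one has \<open>\<Sum>\<^sub>n U(n + s) z\<^sup>n = e\<^bsup>s(1-z)\<^esup> / (1 - z e\<^bsup>1-z\<^esup>)\<close>, which is meromorphic
  in the whole plane. Its poles are the points \<open>1 - \<rho>\<close> with \<open>\<rho>\<close> a characteristic root, and they
  have modulus \<open>e\<^bsup>-Re \<rho>\<^esup>\<close>. The residue theorem on \<open>\<bar>z\<bar> = r\<close> expresses \<open>U(t)\<close> up to \<open>O(r\<^sup>-\<^sup>t)\<close> by the
  poles inside: the double pole \<open>1\<close> contributes \<open>2t + 2/3\<close>, a simple pole \<open>1 - \<rho>\<close> contributes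
  \<open>e\<^bsup>\<rho>t\<^esup> / \<rho>\<close>. For \<open>r = 10\<close> the only simple poles inside belong to the dominant root and its conjugate.
  That root is located by a contraction argument around a ten-digit approximation.
\<close>

section \<open>A numerical enclosure of one characteristic root\<close>

lemma ex_root_near_approximate_root:
  fixes f :: "'a::{banach,real_normed_field} \<Rightarrow> 'a"
  assumes deriv: "\<And>z. z \<in> cball z\<^sub>0 r \<Longrightarrow> (f has_field_derivative f' z) (at z within cball z\<^sub>0 r)"
    and slope: "\<And>z. z \<in> cball z\<^sub>0 r \<Longrightarrow> norm (a - f' z) \<le> norm a / 2"
    and residual: "norm (f z\<^sub>0) \<le> norm a * r / 2" and "a \<noteq> 0" "0 \<le> r"
  obtains z where "z \<in> cball z\<^sub>0 r" "f z = 0"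
proof -
  define T where "T z = z - f z / a" for z
  have contraction: "dist (T x) (T y) \<le> 1/2 * dist x y"
    if "x \<in> cball z\<^sub>0 r" "y \<in> cball z\<^sub>0 r" for x y
    unfolding dist_norm
  proof (rule field_differentiable_bound[OF convex_cball _ _ that])
    fix z assume z: "z \<in> cball z\<^sub>0 r"
    show "(T has_field_derivative (1 - f' z / a)) (at z within cball z\<^sub>0 r)"
      unfolding T_def using \<open>a \<noteq> 0\<close> by (auto intro!: derivative_eq_intros deriv[OF z])
    have "1 - f' z / a = (a - f' z) / a"
      using \<open>a \<noteq> 0\<close> by (simp add: diff_divide_distrib)
    then show "norm (1 - f' z / a) \<le> 1/2"
      using slope[OF z] \<open>a \<noteq> 0\<close> by (simp add: norm_divide field_simps)
  qed
  have "dist z\<^sub>0 (T z\<^sub>0) \<le> r / 2"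
    using residual \<open>a \<noteq> 0\<close> by (simp add: T_def dist_norm norm_divide field_simps)
  then have self_map: "T z \<in> cball z\<^sub>0 r" if "z \<in> cball z\<^sub>0 r" for z
    using contraction[of z\<^sub>0 z] that \<open>0 \<le> r\<close> dist_triangle[of z\<^sub>0 "T z" "T z\<^sub>0"] by simp
  have "\<exists>!z\<in>cball z\<^sub>0 r. T z = z"
    by (rule Banach_fix[where c = "1/2"])
       (use \<open>0 \<le> r\<close> self_map contraction in \<open>auto simp: complete_eq_closed\<close>)
  then show thesis
    using that \<open>a \<noteq> 0\<close> by (auto simp: T_def)
qed

lemma exp_add_approx:
  fixes u v :: "'a::{banach,real_normed_field}"
  assumes u: "norm (exp u - a) \<le> d" "norm a \<le> A" and v: "norm (exp v - b) \<le> e" "norm b \<le> B"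
    and product: "norm (a * b - c) \<le> r"
  shows "norm (exp (u + v) - c) \<le> d * (B + e) + A * e + r"
proof -
  have nonneg: "0 \<le> d" "0 \<le> e" "0 \<le> A" "0 \<le> B"
    using u v by (auto intro: order_trans[OF norm_ge_zero])
  have "norm (exp v) \<le> B + e"
    using v norm_triangle_sub[of "exp v" b] by linarith
  have "exp (u + v) - c = (exp u - a) * exp v + a * (exp v - b) + (a * b - c)"
    by (simp add: exp_add algebra_simps)
  also have "norm \<dots> \<le> norm (exp u - a) * norm (exp v) + norm a * norm (exp v - b) + norm (a * b - c)"
    by (simp add: norm_triangle_le flip: norm_mult)
  also have "\<dots> \<le> d * (B + e) + A * e + r"
    using u v product nonneg \<open>norm (exp v) \<le> B + e\<close> by (intro add_mono mult_mono) auto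
  finally show ?thesis .
qed

fun exp_horner :: "nat \<Rightarrow> nat \<Rightarrow> 'a::field_char_0 \<Rightarrow> 'a" where
  "exp_horner 0 k w = 1"
| "exp_horner (Suc n) k w = 1 + w / of_nat (k + 1) * exp_horner n (k + 1) w"

lemma exp_horner_eq: "exp_horner n k w = (\<Sum>i\<le>n. fact k * w ^ i / fact (k + i))"
proof (induction n arbitrary: k)
  case (Suc n)
  have coeff: "w / of_nat (k + 1) * (fact (k + 1) * w ^ i / fact (k + 1 + i))
      = fact k * w ^ Suc i / fact (k + Suc i)" for i
    by (simp add: mult.assoc divide_simps del: of_nat_Suc)
  show ?case
    by (simp only: exp_horner.simps Suc.IH sum.atMost_Suc_shift sum_distrib_left coeff) simp
qed simp

lemma exp_horner_numeral:
  "exp_horner (numeral n) k w = 1 + w / of_nat (k + 1) * exp_horner (pred_numeral n) (k + 1) w"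
  by (simp add: numeral_eq_Suc)

lemma exp_horner_approx:
  fixes w :: complex
  assumes "norm w \<le> b" "b \<le> 1"
  shows "norm (exp w - exp_horner n 0 w) \<le> 3 * b ^ Suc n / fact n"
proof -
  have "exp \<bar>Re w\<bar> \<le> exp 1"
    using abs_Re_le_cmod[of w] assms by simp
  also have "\<dots> \<le> 3"
    by (rule exp_le)
  finally have "exp \<bar>Re w\<bar> * norm w ^ Suc n / fact n \<le> 3 * b ^ Suc n / fact n"
    using assms(1) by (intro divide_right_mono mult_mono power_mono) auto
  with Taylor_exp[of w n] show ?thesis
    by (simp add: exp_horner_eq)
qed

lemma Complex_add_divide_simps:
  "1 + Complex a b = Complex (1 + a) b"
  "Complex a b / numeral n = Complex (a / numeral n) (b / numeral n)"
  by (simp_all add: complex_eq_iff)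

lemma norm_Complex_le:
  assumes "a\<^sup>2 + b\<^sup>2 \<le> c\<^sup>2" "0 \<le> c"
  shows "norm (Complex a b) \<le> c"
  unfolding complex_norm using assms by (simp add: real_le_lsqrt)

lemma exp_double_approx:
  assumes "norm (exp w - Complex x y) \<le> d" "x\<^sup>2 + y\<^sup>2 \<le> A\<^sup>2" "0 \<le> A"
    and "\<bar>x\<^sup>2 - y\<^sup>2 - x'\<bar> + \<bar>2 * x * y - y'\<bar> \<le> r" "d * (2 * A + d) + r \<le> e"
  shows "norm (exp (2 * w) - Complex x' y') \<le> e"
proof -
  have "norm (Complex x y) \<le> A"
    by (rule norm_Complex_le) fact+
  moreover have "norm (Complex x y * Complex x y - Complex x' y') \<le> r"
    by (rule order_trans[OF cmod_le]) (use assms(4) in \<open>simp add: power2_eq_square\<close>)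
  ultimately have "norm (exp (w + w) - Complex x' y') \<le> d * (A + d) + A * d + r"
    using assms(1) by (intro exp_add_approx)
  also have "\<dots> = d * (2 * A + d) + r"
    by (simp add: algebra_simps)
  finally show ?thesis
    using assms(5) by (simp only: mult_2)
qed

text \<open>
  As \<open>- alpha1\<close> exceeds \<open>2.088843\<close> by less than \<open>1.6 * 10\<^sup>-\<^sup>8\<close>, the root has to be enclosed that tightly.
\<close>

definition approx_root :: complex where
  "approx_root = Complex (- 2.088843016) 7.4614892856"

definition approx_exp :: complex where
  "approx_exp = Complex 3.0888430172 (- 7.4614892884)"

lemma exp_approx_root_div_8:
  "norm (exp (- approx_root / 8) - Complex 0.7734078659 (- 1.0428761122)) \<le> 6 / 10 ^ 10"
proof -
  \<comment> \<open>Two decimals for \<open>u\<close> keep the exact rational arithmetic of the long Horner scheme small.\<close>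
  define u v where "u = Complex 0.26 (- 0.93)" and "v = Complex 0.001105377 (- 0.0026861607)"
  define a b where "a = Complex 0.7753488785 (- 1.0396450194)" and "b = exp_horner 3 0 v"
  note horner_simps = exp_horner_numeral Complex_add_divide_simps complex_mult complex_diff
  have "norm (exp u - exp_horner 13 0 u) \<le> 3 * 0.97 ^ Suc 13 / fact 13"
    unfolding u_def by (intro exp_horner_approx norm_Complex_le) (simp_all add: power_divide)
  moreover have "norm (exp_horner 13 0 u - a) \<le> 8 / 10 ^ 11"
    unfolding u_def a_def by (rule order_trans[OF cmod_le]) (simp add: horner_simps)
  ultimately have "norm (exp u - a) \<le> 3 * 0.97 ^ Suc 13 / fact 13 + 8 / 10 ^ 11"
    using norm_diff_triangle_le by blast
  then have exp_u: "norm (exp u - a) \<le> 4 / 10 ^ 10"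
    by (rule order_trans) (simp add: fact_numeral power_divide)
  have "norm (exp v - b) \<le> 3 * 0.003 ^ Suc 3 / fact 3"
    unfolding v_def b_def by (intro exp_horner_approx norm_Complex_le) (simp_all add: power_divide)
  then have exp_v: "norm (exp v - b) \<le> 5 / 10 ^ 11"
    by (rule order_trans) (simp add: fact_numeral power_divide)
  have norm_a: "norm a \<le> 1.3"
    unfolding a_def by (rule norm_Complex_le) (simp_all add: power_divide)
  have norm_b: "norm b \<le> 1.01"
    unfolding b_def v_def by (rule order_trans[OF cmod_le]) (simp add: horner_simps)
  have "norm (a * b - Complex 0.7734078659 (- 1.0428761122)) \<le> 1 / 10 ^ 10"
    unfolding a_def b_def v_def by (rule order_trans[OF cmod_le]) (simp add: horner_simps)
  note exp_add_approx[OF exp_u norm_a exp_v norm_b this]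
  moreover have "- approx_root / 8 = u + v"
    by (simp add: approx_root_def u_def v_def complex_eq_iff)
  ultimately show ?thesis
    by simp
qed

lemma exp_approx_root: "norm (exp (- approx_root) - approx_exp) \<le> 5 / 10 ^ 8"
proof -
  let ?w = "- approx_root / 8"
  have "norm (exp (2 * ?w) - Complex (- 0.4894308583) (- 1.6131371767)) \<le> 2 / 10 ^ 9"
    by (rule exp_double_approx[OF exp_approx_root_div_8, where A = "1.3" and r = "4 / 10 ^ 10"])
       (simp_all add: power_divide)
  then have "norm (exp (2 * (2 * ?w)) - Complex (- 2.3626689858) 1.5790382261) \<le> 8 / 10 ^ 9"
    by (rule exp_double_approx[where A = "1.7" and r = "4 / 10 ^ 10"]) (simp_all add: power_divide)
  then have "norm (exp (2 * (2 * (2 * ?w))) - approx_exp) \<le> 5 / 10 ^ 8"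
    unfolding approx_exp_def
    by (rule exp_double_approx[where A = "2.9" and r = "1 / 10 ^ 9"]) (simp_all add: power_divide)
  then show ?thesis
    by simp
qed

lemma norm_exp_diff_le:
  fixes w z :: "'a::{banach,real_normed_field}"
  shows "norm (exp w - exp z) \<le> norm (exp z) * (exp (norm (w - z)) * norm (w - z))"
proof -
  have "exp w - exp z = exp z * (exp (w - z) - 1)"
    by (simp add: right_diff_distrib flip: exp_add)
  then have "norm (exp w - exp z) = norm (exp z) * norm (exp (w - z) - 1)"
    by (simp only: norm_mult)
  also have "\<dots> \<le> norm (exp z) * (exp (norm (w - z)) * norm (w - z))"
    using Taylor_exp_field[of "w - z" 0] by (intro mult_left_mono) auto
  finally show ?thesis .
qed

lemma exp_near_approx_root:
  assumes "norm (z - approx_root) \<le> 1 / 100"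
  shows "norm (exp (- z) - approx_exp) \<le> 1"
proof -
  have "norm approx_exp \<le> 9"
    unfolding approx_exp_def by (rule norm_Complex_le) (simp_all add: power_divide)
  then have "norm (exp (- approx_root)) \<le> 10"
    using exp_approx_root norm_triangle_sub[of "exp (- approx_root)" approx_exp] by simp
  have "norm (exp (- z) - exp (- approx_root))
      \<le> norm (exp (- approx_root)) * (exp (norm (z - approx_root)) * norm (z - approx_root))"
    using norm_exp_diff_le[of "- z" "- approx_root"] by (simp add: norm_minus_commute)
  also have "\<dots> \<le> 10 * (exp 1 * (1 / 100))"
    using assms \<open>norm (exp (- approx_root)) \<le> 10\<close> by (intro mult_mono) auto
  also have "\<dots> \<le> 3 / 10"
    using exp_le by simp
  finally show ?thesis
    using exp_approx_root
      norm_triangle_ineq[of "exp (- z) - exp (- approx_root)" "exp (- approx_root) - approx_exp"]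
    by simp
qed

lemma ex_char_root_near_approx_root:
  obtains z where "char_root z" "norm (z - approx_root) \<le> 1.6 / 10 ^ 8"
proof -
  define r :: real where "r = 1.6 / 10 ^ 8"
  have slope: "7.46 \<le> norm (1 - approx_exp)"
    using abs_Im_le_cmod[of "1 - approx_exp"] by (simp add: approx_exp_def)
  obtain z where "z \<in> cball approx_root r" "z - 1 + exp (- z) = 0"
  proof (rule ex_root_near_approximate_root)
    fix z assume z: "z \<in> cball approx_root r"
    show "((\<lambda>z. z - 1 + exp (- z)) has_field_derivative 1 - exp (- z))
        (at z within cball approx_root r)"
      by (auto intro!: derivative_eq_intros)
    have "norm (exp (- z) - approx_exp) \<le> 1"
      using z by (intro exp_near_approx_root) (simp add: r_def dist_norm norm_minus_commute)
    with slope show "norm ((1 - approx_exp) - (1 - exp (- z))) \<le> norm (1 - approx_exp) / 2"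
      by simp
  next
    have "norm (approx_root - 1 + approx_exp) \<le> 5 / 10 ^ 9"
      unfolding approx_root_def approx_exp_def by (rule order_trans[OF cmod_le]) simp
    then have "norm (approx_root - 1 + exp (- approx_root)) \<le> 7.46 * r / 2"
      using exp_approx_root
        norm_triangle_ineq[of "approx_root - 1 + approx_exp" "exp (- approx_root) - approx_exp"]
      by (simp add: r_def add_diff_eq diff_add_eq)
    with slope show "norm (approx_root - 1 + exp (- approx_root)) \<le> norm (1 - approx_exp) * r / 2"
      by (simp add: r_def)
  qed (use slope in \<open>auto simp: r_def\<close>)
  then show thesis
    using that by (simp add: char_root_def r_def dist_norm norm_minus_commute)
qed

section \<open>The dominant characteristic root\<close>

lemma char_root_cnj_iff: "char_root (cnj z) \<longleftrightarrow> char_root z"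
proof -
  have "char_root (cnj z) \<longleftrightarrow> cnj (z - 1 + exp (- z)) = 0"
    by (simp add: char_root_def exp_cnj)
  then show ?thesis
    by (simp add: char_root_def del: complex_cnj_diff complex_cnj_add)
qed

lemma char_root_norm:
  assumes "char_root z"
  shows "norm (1 - z) = exp (- Re z)"
proof -
  have "1 - z = exp (- z)"
    using assms by (simp add: char_root_def algebra_simps)
  then show ?thesis
    by simp
qed

lemma char_root_Complex_iff:
  "char_root (Complex a b) \<longleftrightarrow> exp (- a) * cos b = 1 - a \<and> exp (- a) * sin b = b"
  by (auto simp: char_root_def complex_eq_iff Re_exp Im_exp)

lemma char_root_of_real_iff: "char_root (of_real x) \<longleftrightarrow> x = 0"
proof
  assume "char_root (of_real x)"
  then have exp_x: "exp (- x) = 1 - x"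
    using char_root_Complex_iff[of x 0] by (simp add: complex_of_real_def)
  then have "0 < 1 - x"
    by (metis exp_gt_zero)
  moreover have "ln (1 - x) = (1 - x) - 1"
    using ln_exp[of "- x"] by (simp only: exp_x)
  ultimately show "x = 0"
    using ln_eq_minus_one[of "1 - x"] by simp
qed (simp add: char_root_def)

text \<open>Eliminating \<open>a\<close> from the two real equations for \<open>a + b i\<close> leaves \<open>imag_part_eqn b = 0\<close>.\<close>

definition imag_part_eqn :: "real \<Rightarrow> real" where
  "imag_part_eqn b = ln (sin b / b) - 1 + b * cos b / sin b"

lemma char_root_imag_part_eqn:
  assumes "char_root z" "Im z > 0"
  shows "sin (Im z) > 0" and "exp (- Re z) = Im z / sin (Im z)" and "imag_part_eqn (Im z) = 0"
proof -
  define a b where "a = Re z" and "b = Im z"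
  have eqns: "exp (- a) * cos b = 1 - a" "exp (- a) * sin b = b" and "b > 0"
    using assms char_root_Complex_iff[of a b] by (simp_all add: a_def b_def)
  then have "sin b > 0"
    by (metis exp_gt_zero zero_less_mult_pos)
  then have exp_a: "exp (- a) = b / sin b"
    using eqns(2) by (simp add: field_simps)
  then have "ln (sin b / b) = a"
    by (metis exp_minus inverse_divide inverse_inverse_eq ln_exp)
  then have "imag_part_eqn b = 0"
    using eqns(1) by (simp add: imag_part_eqn_def exp_a)
  with \<open>sin b > 0\<close> exp_a
  show "sin (Im z) > 0" "exp (- Re z) = Im z / sin (Im z)" "imag_part_eqn (Im z) = 0"
    by (simp_all add: a_def b_def)
qed

lemma imag_part_eqn_has_derivative:
  assumes "b > 0" "sin b > 0"
  shows "(imag_part_eqn has_real_derivative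
    - ((b - sin b * cos b)\<^sup>2 + sin b ^ 4) / (b * (sin b)\<^sup>2)) (at b)"
proof -
  have "(imag_part_eqn has_real_derivative
          (cos b * b - sin b) / (b * b) / (sin b / b)
          + ((cos b - b * sin b) * sin b - b * cos b * cos b) / (sin b * sin b)) (at b)"
    unfolding imag_part_eqn_def using assms by (auto intro!: derivative_eq_intros simp: field_simps)
  also have "(cos b * b - sin b) / (b * b) / (sin b / b)
          + ((cos b - b * sin b) * sin b - b * cos b * cos b) / (sin b * sin b)
      = ((cos b * b - sin b) * sin b + b * ((cos b - b * sin b) * sin b - b * cos b * cos b))
          / (b * (sin b)\<^sup>2)"
    using assms by (simp add: divide_simps) (simp add: power2_eq_square algebra_simps)
  also have "(cos b * b - sin b) * sin b + b * ((cos b - b * sin b) * sin b - b * cos b * cos b)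
      = - ((b - sin b * cos b)\<^sup>2 + sin b ^ 4)"
    using sin_cos_squared_add[of b] by algebra
  finally show ?thesis .
qed

lemma imag_part_eqn_strict_decreasing:
  assumes "0 < b" "b < c" "\<And>x. b \<le> x \<Longrightarrow> x \<le> c \<Longrightarrow> sin x > 0"
  shows "imag_part_eqn c < imag_part_eqn b"
proof (rule DERIV_neg_imp_decreasing[OF assms(2)])
  fix x assume "b \<le> x" "x \<le> c"
  with assms have "x > 0" "sin x > 0"
    by auto
  moreover from this have "- ((x - sin x * cos x)\<^sup>2 + sin x ^ 4) / (x * (sin x)\<^sup>2) < 0"
    by (intro divide_neg_pos mult_pos_pos iffD2[OF neg_less_0_iff_less] add_nonneg_pos) auto
  ultimately show "\<exists>y. (imag_part_eqn has_real_derivative y) (at x) \<and> y < 0"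
    using imag_part_eqn_has_derivative by blast
qed

lemma imag_part_eqn_neg:
  assumes "0 < b" "b < pi"
  shows "imag_part_eqn b < 0"
proof -
  have lim: "(imag_part_eqn \<longlongrightarrow> 0) (at_right 0)"
    unfolding imag_part_eqn_def by real_asymp
  have decreasing: "imag_part_eqn c < imag_part_eqn a" if "0 < a" "a < c" "c < pi" for a c
    using that by (intro imag_part_eqn_strict_decreasing sin_gt_zero) auto
  have "eventually (\<lambda>x. imag_part_eqn (b / 2) \<le> imag_part_eqn x) (at_right 0)"
    using eventually_at_right_real[of 0 "b / 2"]
    by (rule eventually_mono) (use assms in \<open>auto intro!: less_imp_le decreasing\<close>)
  then have "imag_part_eqn (b / 2) \<le> 0"
    by (rule tendsto_lowerbound[OF lim]) simp
  with decreasing[of "b / 2" b] assms show ?thesis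
    by simp
qed

lemma char_root_Im_bounds:
  assumes z: "char_root z" "Im z > 0" and "exp (- Re z) < 4 * pi"
  shows "2 * pi < Im z" "Im z < 3 * pi"
proof -
  note sin_pos = char_root_imag_part_eqn(1)[OF z]
  have "Im z \<le> Im z / sin (Im z)"
    using z(2) sin_pos by (simp add: field_simps)
  then have "Im z < 4 * pi"
    using assms(3) char_root_imag_part_eqn(2)[OF z] by simp
  moreover have "\<not> Im z < pi"
    using imag_part_eqn_neg[of "Im z"] char_root_imag_part_eqn(3)[OF z] z(2) by auto
  moreover have "\<not> (pi \<le> Im z \<and> Im z \<le> 2 * pi)"
    using sin_le_zero[of "Im z"] sin_pos by (cases "Im z = 2 * pi") auto
  moreover have "\<not> (3 * pi \<le> Im z \<and> Im z < 4 * pi)"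
    using sin_le_zero[of "Im z - 2 * pi"] sin_pos by (auto simp: sin_diff)
  ultimately show "2 * pi < Im z" "Im z < 3 * pi"
    by linarith+
qed

lemma char_root_unique_upper:
  assumes z: "char_root z" "Im z > 0" "exp (- Re z) < 4 * pi"
    and w: "char_root w" "Im w > 0" "exp (- Re w) < 4 * pi"
  shows "z = w"
proof -
  have not_less: "\<not> Im u < Im v"
    if u: "char_root u" "Im u > 0" "exp (- Re u) < 4 * pi"
      and v: "char_root v" "Im v > 0" "exp (- Re v) < 4 * pi" for u v
  proof
    assume "Im u < Im v"
    then have "imag_part_eqn (Im v) < imag_part_eqn (Im u)"
    proof (rule imag_part_eqn_strict_decreasing[OF u(2)])
      fix x assume "Im u \<le> x" "x \<le> Im v"
      with char_root_Im_bounds[OF u] char_root_Im_bounds[OF v] show "sin x > 0"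
        using sin_gt_zero[of "x - 2 * pi"] by (simp add: sin_diff)
    qed
    then show False
      using char_root_imag_part_eqn(3) u v by simp
  qed
  from not_less[OF z w] not_less[OF w z] have "Im z = Im w"
    by simp
  moreover from this have "exp (- Re z) = exp (- Re w)"
    using char_root_imag_part_eqn(2) z w by simp
  ultimately show ?thesis
    by (simp add: complex_eq_iff)
qed

definition dominant_root :: complex where
  "dominant_root = (THE z. char_root z \<and> Im z > 0 \<and> exp (- Re z) < 4 * pi)"

lemma dominant_root_enclosure:
  shows char_root_dominant_root: "char_root dominant_root"
    and Re_dominant_root: "2.088843 \<le> - Re dominant_root" "- Re dominant_root < 2.088844"
    and Im_dominant_root: "7.461489 \<le> Im dominant_root" "Im dominant_root < 7.461490"
    and exp_minus_Re_dominant_root: "exp (- Re dominant_root) < 10"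
proof -
  obtain z where root: "char_root z" and near: "norm (z - approx_root) \<le> 1.6 / 10 ^ 8"
    using ex_char_root_near_approx_root .
  have "\<bar>Re z - (- 2.088843016)\<bar> \<le> 1.6 / 10 ^ 8" "\<bar>Im z - 7.4614892856\<bar> \<le> 1.6 / 10 ^ 8"
    using order_trans[OF abs_Re_le_cmod near] order_trans[OF abs_Im_le_cmod near]
    by (simp_all add: approx_root_def)
  then have Re: "2.088843 \<le> - Re z" "- Re z < 2.088844" and Im: "7.461489 \<le> Im z" "Im z < 7.461490"
    unfolding abs_diff_le_iff by simp_all
  have "(1 - Re z)\<^sup>2 + (Im z)\<^sup>2 \<le> 4\<^sup>2 + 8\<^sup>2"
    using Re Im by (intro add_mono power_mono) auto
  then have "norm (1 - z) < 10"
    unfolding cmod_def by (intro real_less_lsqrt) auto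
  then have exp: "exp (- Re z) < 10"
    by (simp add: char_root_norm[OF root])
  with pi_gt3 have "exp (- Re z) < 4 * pi"
    by linarith
  with root Im have "dominant_root = z"
    unfolding dominant_root_def by (intro the_equality) (auto intro: char_root_unique_upper)
  with root Re Im exp show "char_root dominant_root"
    "2.088843 \<le> - Re dominant_root" "- Re dominant_root < 2.088844"
    "7.461489 \<le> Im dominant_root" "Im dominant_root < 7.461490" "exp (- Re dominant_root) < 10"
    by simp_all
qed

lemma nonzero_char_root_cases:
  assumes z: "char_root z" "z \<noteq> 0" "exp (- Re z) < 4 * pi"
  shows "z = dominant_root \<or> z = cnj dominant_root"
proof -
  have upper: "w = dominant_root" if "char_root w" "Im w > 0" "exp (- Re w) < 4 * pi" for w
    using that dominant_root_enclosure pi_gt3 by (intro char_root_unique_upper) auto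
  consider "Im z > 0" | "Im z < 0" | "Im z = 0"
    by linarith
  then show ?thesis
  proof cases
    case 1
    then show ?thesis
      using upper z by blast
  next
    case 2
    then have "cnj z = dominant_root"
      using upper[of "cnj z"] z by (simp add: char_root_cnj_iff)
    then show ?thesis
      by (metis complex_cnj_cnj)
  next
    case 3
    then have "z = of_real (Re z)"
      by (simp add: complex_eq_iff)
    with z show ?thesis
      using char_root_of_real_iff by (metis of_real_0)
  qed
qed

lemma alpha1_eq_Re_dominant_root: "alpha1 = Re dominant_root"
  unfolding alpha1_def
proof (rule Greatest_equality)
  show "\<exists>z. z \<noteq> 0 \<and> char_root z \<and> Re z = Re dominant_root"
    using char_root_dominant_root Im_dominant_root by (intro exI[of _ dominant_root]) auto
next
  fix a assume "\<exists>z. z \<noteq> 0 \<and> char_root z \<and> Re z = a"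
  then obtain z where z: "z \<noteq> 0" "char_root z" "Re z = a"
    by blast
  show "a \<le> Re dominant_root"
  proof (cases "exp (- Re z) < 4 * pi")
    case True
    then show ?thesis
      using nonzero_char_root_cases[OF z(2,1)] z(3) by auto
  next
    case False
    then have "exp (- Re dominant_root) < exp (- Re z)"
      using exp_minus_Re_dominant_root pi_gt3 by linarith
    then show ?thesis
      using z(3) by simp
  qed
qed

section \<open>The Irwin--Hall distribution\<close>

text \<open>\<open>max 0 x ^ n\<close> would differ at \<open>n = 0\<close>, where negative \<open>x\<close> must give \<open>0\<close>.\<close>

definition trunc_power :: "nat \<Rightarrow> real \<Rightarrow> real" where
  "trunc_power n x = (if x \<ge> 0 then x ^ n else 0)"

lemma trunc_power_Suc_eq: "trunc_power (Suc n) x = max 0 x ^ Suc n"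
  by (simp add: trunc_power_def max_def)

lemma trunc_power_Suc_has_derivative:
  assumes "x \<noteq> 0"
  shows "(trunc_power (Suc n) has_real_derivative real (Suc n) * trunc_power n x) (at x)"
proof (cases "x > 0")
  case True
  have "((\<lambda>x. x ^ Suc n) has_real_derivative real (Suc n) * x ^ n) (at x)"
    by (auto intro!: derivative_eq_intros simp del: power_Suc)
  then have "(trunc_power (Suc n) has_real_derivative real (Suc n) * x ^ n) (at x)"
    by (rule has_field_derivative_transform_within_open[of _ _ _ "{0<..}"])
       (use True in \<open>auto simp: trunc_power_def\<close>)
  with True show ?thesis
    by (simp add: trunc_power_def)
next
  case False
  have "((\<lambda>x. 0) has_real_derivative 0) (at x)"
    by simp
  then have "(trunc_power (Suc n) has_real_derivative 0) (at x)"
    by (rule has_field_derivative_transform_within_open[of _ _ _ "{..<0}"])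
       (use False assms in \<open>auto simp: trunc_power_def\<close>)
  with False assms show ?thesis
    by (simp add: trunc_power_def)
qed

lemma trunc_power_has_integral:
  "((\<lambda>x. trunc_power n (t - x)) has_integral
      (trunc_power (Suc n) t - trunc_power (Suc n) (t - 1)) / real (Suc n)) {0..1}"
proof -
  let ?G = "\<lambda>x. - (trunc_power (Suc n) (t - x) / real (Suc n))"
  have "((\<lambda>x. trunc_power n (t - x)) has_integral (?G 1 - ?G 0)) {0..1}"
  proof (rule fundamental_theorem_of_calculus_interior_strong[of "{t}"])
    show "continuous_on {0..1} ?G"
      unfolding trunc_power_Suc_eq by (intro continuous_intros) auto
    fix x assume "x \<in> {0<..<1} - {t}"
    then have "(?G has_real_derivative trunc_power n (t - x)) (at x)"
      by (auto intro!: derivative_eq_intros DERIV_chain2[OF trunc_power_Suc_has_derivative]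
          simp del: of_nat_Suc)
    then show "(?G has_vector_derivative trunc_power n (t - x)) (at x)"
      by (simp add: has_real_derivative_iff_has_vector_derivative)
  qed auto
  then show ?thesis
    by (simp add: diff_divide_distrib)
qed

definition irwin_hall :: "nat \<Rightarrow> real \<Rightarrow> real" where
  "irwin_hall n t = (\<Sum>k\<le>n. (- 1) ^ k * real (n choose k) * trunc_power n (t - real k)) / fact n"

lemma alternating_binomial_sum_Suc:
  fixes g :: "nat \<Rightarrow> 'a::comm_ring_1"
  shows "(\<Sum>k\<le>Suc n. (- 1) ^ k * of_nat (Suc n choose k) * g k)
      = (\<Sum>k\<le>n. (- 1) ^ k * of_nat (n choose k) * (g k - g (Suc k)))"
proof -
  have "(\<Sum>k\<le>Suc n. (- 1) ^ k * of_nat (Suc n choose k) * g k)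
      = g 0 + (\<Sum>k\<le>n. (- 1) ^ Suc k * of_nat (n choose Suc k) * g (Suc k))
        + (\<Sum>k\<le>n. (- 1) ^ Suc k * of_nat (n choose k) * g (Suc k))"
    by (subst sum.atMost_Suc_shift) (simp add: algebra_simps flip: sum.distrib)
  also have "g 0 + (\<Sum>k\<le>n. (- 1) ^ Suc k * of_nat (n choose Suc k) * g (Suc k))
      = (\<Sum>k\<le>n. (- 1) ^ k * of_nat (n choose k) * g k)"
    using sum.atMost_Suc_shift[of "\<lambda>k. (- 1) ^ k * of_nat (n choose k) * g k" n]
    by (simp add: binomial_eq_0)
  finally show ?thesis
    by (simp add: algebra_simps sum_subtractf sum_negf)
qed

lemma irwin_hall_has_integral:
  "((\<lambda>x. irwin_hall n (t - x)) has_integral irwin_hall (Suc n) t) {0..1}"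
proof -
  let ?c = "\<lambda>k. (- 1) ^ k * real (n choose k)" and ?g = "\<lambda>k. trunc_power (Suc n) (t - real k)"
  have "((\<lambda>x. (\<Sum>k\<le>n. ?c k * trunc_power n (t - real k - x)) / fact n) has_integral
      (\<Sum>k\<le>n. ?c k * ((?g k - trunc_power (Suc n) (t - real k - 1)) / real (Suc n))) / fact n) {0..1}"
    by (intro has_integral_divide has_integral_sum has_integral_mult_right trunc_power_has_integral)
       simp
  moreover have "(\<Sum>k\<le>n. ?c k * ((?g k - trunc_power (Suc n) (t - real k - 1)) / real (Suc n))) / fact n
      = (\<Sum>k\<le>n. ?c k * (?g k - ?g (Suc k))) / fact (Suc n)"
    by (simp add: sum_divide_distrib algebra_simps)
  ultimately show ?thesis
    unfolding irwin_hall_def alternating_binomial_sum_Suc by (simp add: algebra_simps)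
qed

lemma binomial_exp_sums:
  fixes x :: real
  shows "(\<lambda>n. real (n choose k) * x ^ n / fact n) sums (x ^ k * exp x / fact k)"
proof -
  have shift: "real ((n + k) choose k) * x ^ (n + k) / fact (n + k)
      = x ^ k / fact k * (x ^ n /\<^sub>R fact n)" for n
    by (subst binomial_fact) (auto simp: power_add field_simps)
  have "(\<lambda>n. real ((n + k) choose k) * x ^ (n + k) / fact (n + k)) sums (x ^ k * exp x / fact k)"
    unfolding shift using sums_mult[OF exp_converges, of "x ^ k / fact k" x] by simp
  then show ?thesis
    by (subst sums_iff_shift'[of _ k, symmetric]) (simp add: binomial_eq_0)
qed

lemma times_binomial_eq: "n * (n choose k) = k * (n choose k) + Suc k * (n choose Suc k)"
proof (cases "k \<le> n")
  case True
  have "Suc k * (n choose Suc k) = (n - k) * (n choose k)"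
    by (simp only: binomial_absorb_comp binomial_absorption)
  with True show ?thesis
    by (simp only: add_mult_distrib[symmetric]) simp
qed (simp add: binomial_eq_0)

lemma binomial_exp_sums_times:
  fixes x :: real
  shows "(\<lambda>n. real n * (real (n choose k) * x ^ n / fact n)) sums ((real k + x) * (x ^ k * exp x / fact k))"
proof -
  let ?term = "\<lambda>k n. real (n choose k) * x ^ n / fact n"
  have "(\<lambda>n. real k * ?term k n + real (Suc k) * ?term (Suc k) n)
      sums (real k * (x ^ k * exp x / fact k) + real (Suc k) * (x ^ Suc k * exp x / fact (Suc k)))"
    by (intro sums_add sums_mult binomial_exp_sums)
  also have "(\<lambda>n. real k * ?term k n + real (Suc k) * ?term (Suc k) n) = (\<lambda>n. real n * ?term k n)"
  proof
    fix n
    have "real k * ?term k n + real (Suc k) * ?term (Suc k) n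
        = real (k * (n choose k) + Suc k * (n choose Suc k)) * x ^ n / fact n"
      by (simp add: distrib_right add_divide_distrib)
    also have "\<dots> = real n * ?term k n"
      unfolding times_binomial_eq[symmetric] by simp
    finally show "real k * ?term k n + real (Suc k) * ?term (Suc k) n = real n * ?term k n" .
  qed
  also have "real k * (x ^ k * exp x / fact k) + real (Suc k) * (x ^ Suc k * exp x / fact (Suc k))
      = (real k + x) * (x ^ k * exp x / fact k)"
    by (simp add: field_simps del: of_nat_Suc)
  finally show ?thesis .
qed

definition renewal_fun :: "real \<Rightarrow> real" where
  "renewal_fun t = (\<Sum>k\<le>nat \<lfloor>t\<rfloor>. (- 1) ^ k * (t - real k) ^ k * exp (t - real k) / fact k)"

lemma irwin_hall_floor:
  assumes "t \<ge> 0"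
  shows "irwin_hall n t = (\<Sum>k\<le>nat \<lfloor>t\<rfloor>. (- 1) ^ k * (real (n choose k) * (t - real k) ^ n / fact n))"
proof -
  let ?f = "\<lambda>k. (- 1) ^ k * real (n choose k) * trunc_power n (t - real k)"
  have floor: "k \<le> nat \<lfloor>t\<rfloor> \<longleftrightarrow> real k \<le> t" for k
    using assms by linarith
  have "(\<Sum>k\<le>n. ?f k) = (\<Sum>k\<in>{..n} \<inter> {..nat \<lfloor>t\<rfloor>}. ?f k)"
    using floor by (intro sum.mono_neutral_right) (auto simp: trunc_power_def)
  also have "\<dots> = (\<Sum>k\<le>nat \<lfloor>t\<rfloor>. ?f k)"
    by (intro sum.mono_neutral_left) (auto simp: binomial_eq_0)
  also have "\<dots> = (\<Sum>k\<le>nat \<lfloor>t\<rfloor>. (- 1) ^ k * (real (n choose k) * (t - real k) ^ n))"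
    using floor by (intro sum.cong) (auto simp: trunc_power_def)
  finally show ?thesis
    by (simp add: irwin_hall_def sum_divide_distrib)
qed

lemma irwin_hall_sums:
  assumes "t \<ge> 0"
  shows "(\<lambda>n. irwin_hall n t) sums renewal_fun t"
proof -
  have "(\<lambda>n. irwin_hall n t) sums
      (\<Sum>k\<le>nat \<lfloor>t\<rfloor>. (- 1) ^ k * ((t - real k) ^ k * exp (t - real k) / fact k))"
    unfolding irwin_hall_floor[OF assms] by (intro sums_sum sums_mult binomial_exp_sums)
  then show ?thesis
    by (simp add: renewal_fun_def mult.assoc)
qed

lemma irwin_hall_sums_times:
  assumes "t \<ge> 0"
  shows "(\<lambda>n. real n * irwin_hall n t) sums (t * renewal_fun t)"
proof -
  have "(\<lambda>n. \<Sum>k\<le>nat \<lfloor>t\<rfloor>. (- 1) ^ k * (real n * (real (n choose k) * (t - real k) ^ n / fact n)))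
      sums (\<Sum>k\<le>nat \<lfloor>t\<rfloor>. (- 1) ^ k *
        ((real k + (t - real k)) * ((t - real k) ^ k * exp (t - real k) / fact k)))"
    by (intro sums_sum sums_mult binomial_exp_sums_times)
  then show ?thesis
    by (simp add: irwin_hall_floor[OF assms] renewal_fun_def sum_distrib_left mult_ac)
qed

section \<open>Power series coefficients and residues\<close>

lemma fps_divide_one_minus_nth:
  fixes B E :: "'a::field fps"
  assumes E: "fps_nth E 0 = 0"
  shows "fps_nth (B / (1 - E)) n = (\<Sum>j\<le>n. fps_nth (E ^ j * B) n)"
proof -
  have geometric: "fps_nth (1 / (1 - E)) m = (\<Sum>j\<le>n. fps_nth (E ^ j) m)" if "m \<le> n" for m
  proof -
    have "fps_nth (1 / (1 - E)) m = (\<Sum>j\<le>m. fps_nth (E ^ j) m)"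
      by (simp add: fps_compose_nth atLeast0AtMost flip: gp[OF E])
    also have "\<dots> = (\<Sum>j\<le>n. fps_nth (E ^ j) m)"
      using that startsby_zero_power_prefix[OF E] by (intro sum.mono_neutral_left) auto
    finally show ?thesis .
  qed
  have "B / (1 - E) = B * (1 / (1 - E))"
    using E by (simp add: fps_divide_unit)
  then have "fps_nth (B / (1 - E)) n = (\<Sum>i\<le>n. fps_nth B i * (\<Sum>j\<le>n. fps_nth (E ^ j) (n - i)))"
    by (simp add: fps_mult_nth atLeast0AtMost geometric)
  also have "\<dots> = (\<Sum>j\<le>n. \<Sum>i\<le>n. fps_nth B i * fps_nth (E ^ j) (n - i))"
    unfolding sum_distrib_left by (rule sum.swap)
  also have "\<dots> = (\<Sum>j\<le>n. fps_nth (E ^ j * B) n)"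
    by (simp add: fps_mult_nth atLeast0AtMost mult.commute[of _ B])
  finally show ?thesis .
qed

lemma fps_divide_nth_1:
  fixes F H :: "'a::field fps"
  assumes "fps_nth H 0 \<noteq> 0"
  shows "fps_nth (F / H) 1 = fps_nth F 1 / fps_nth H 0 - fps_nth F 0 * fps_nth H 1 / (fps_nth H 0)\<^sup>2"
proof -
  define Q where "Q = F / H"
  have "F = Q * H"
    using assms by (simp add: Q_def fps_divide_unit inverse_mult_eq_1 mult.assoc)
  then have "fps_nth F 0 = fps_nth Q 0 * fps_nth H 0"
      "fps_nth F 1 = fps_nth Q 0 * fps_nth H 1 + fps_nth Q 1 * fps_nth H 0"
    by (simp_all add: fps_mult_nth)
  then show ?thesis
    using assms by (simp add: field_simps power2_eq_square flip: Q_def)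
qed

lemma residue_divide_double_zero:
  assumes f: "f analytic_on {p}" and g: "(\<lambda>w. g (p + w)) has_fps_expansion G"
    and zero: "fps_nth G 0 = 0" "fps_nth G 1 = 0" "fps_nth G 2 \<noteq> 0"
  shows "residue (\<lambda>z. f z / g z) p = deriv f p / fps_nth G 2 - f p * fps_nth G 3 / (fps_nth G 2)\<^sup>2"
proof -
  define F where "F = fps_expansion f p"
  define H where "H = fps_shift 2 G"
  have F: "(\<lambda>w. f (p + w)) has_fps_expansion F"
    using analytic_at_imp_has_fps_expansion[OF f] by (simp add: F_def)
  have H: "fps_nth H 0 = fps_nth G 2" "fps_nth H 1 = fps_nth G 3"
    by (simp_all add: H_def eval_nat_numeral)
  have "subdegree G = 2"
    using zero by (intro subdegreeI) (auto simp: less_2_cases_iff)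
  then have "G = H * fps_X ^ 2"
    unfolding H_def by (metis subdegree_decompose)
  then have "fps_to_fls F / fps_to_fls G = fps_to_fls F / fps_to_fls H / fls_X ^ 2"
    by (simp only: fls_times_fps_to_fls fps_to_fls_power fps_X_to_fls divide_divide_eq_left)
  also have "fps_to_fls F / fps_to_fls H = fps_to_fls (F / H)"
    using H(1) zero(3) by (intro fls_divide_fps_to_fls) (simp add: subdegree_eq_0)
  also have "fps_to_fls (F / H) / fls_X ^ 2 = fls_shift 2 (fps_to_fls (F / H))"
    by (simp add: fls_X_power_conv_shift_1 fls_divide_shift_denom)
  finally have "(\<lambda>w. f (p + w) / g (p + w)) has_laurent_expansion fls_shift 2 (fps_to_fls (F / H))"
    using has_laurent_expansion_divide[OF has_laurent_expansion_fps[OF F] has_laurent_expansion_fps[OF g]]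
    by simp
  then have "residue (\<lambda>z. f z / g z) p = fps_nth (F / H) 1"
    by (simp add: has_laurent_expansion_residue)
  also have "\<dots> = deriv f p / fps_nth G 2 - f p * fps_nth G 3 / (fps_nth G 2)\<^sup>2"
    using fps_divide_nth_1[of H F] zero(3) unfolding H by (simp add: F_def fps_expansion_def)
  finally show ?thesis .
qed

lemma finite_zeros_cball:
  fixes h :: "complex \<Rightarrow> complex"
  assumes "h holomorphic_on UNIV" "h a \<noteq> 0"
  shows "finite {z \<in> cball c r. h z = 0}"
proof (cases "h constant_on UNIV")
  case True
  then have "h z \<noteq> 0" for z
    using assms(2) by (metis UNIV_I constant_on_def)
  then show ?thesis
    by simp
next
  case False
  then show ?thesis
    using assms(1) by (intro holomorphic_compact_finite_zeros[where S = UNIV]) auto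
qed

lemma fps_coeff_quotient_bound:
  fixes g h :: "complex \<Rightarrow> complex"
  assumes hol: "g holomorphic_on UNIV" "h holomorphic_on UNIV"
    and expansion: "(\<lambda>z. g z / h z) has_fps_expansion F" and "h 0 \<noteq> 0" "0 < r"
    and circle: "\<And>z. norm z = r \<Longrightarrow> h z \<noteq> 0 \<and> norm (g z / h z) \<le> B"
  shows "norm (fps_nth F n + (\<Sum>p | p \<in> ball 0 r \<and> h p = 0. residue (\<lambda>z. g z / h z / z ^ Suc n) p))
    \<le> B / r ^ n"
proof -
  define S where "S = {p. p \<in> ball 0 r \<and> h p = 0}"
  define outer where "outer = {z \<in> cball 0 (r + 1). h z = 0} - S"
  have finite: "finite S" "finite outer"
    using finite_zeros_cball[OF hol(2) \<open>h 0 \<noteq> 0\<close>, of 0 "r + 1"]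
    by (auto simp: S_def outer_def elim!: rev_finite_subset)
  have outer: "r < norm z" if "z \<in> outer" for z
    using that circle[of z] by (cases "norm z" r rule: linorder_cases) (auto simp: outer_def S_def)
  define A where "A = ball 0 (r + 1) - outer"
  have "norm ((deriv ^^ n) (\<lambda>z. g z / h z) 0 / fact n
      + (\<Sum>p\<in>S. residue (\<lambda>z. g z / h z / z ^ Suc n) p)) \<le> B / r ^ n"
  proof (rule fps_coeff_residues_bound[where A = A and k = "{}"])
    show "open A" "connected A"
      unfolding A_def using finite
      by (auto intro!: open_Diff finite_imp_closed connected_open_delete_finite)
    show "cball 0 r \<subseteq> A"
      using outer by (force simp: A_def)
    show "(\<lambda>z. g z / h z) holomorphic_on A - S"
      using hol
      by (intro holomorphic_on_divide) (auto simp: A_def outer_def elim!: holomorphic_on_subset)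
    have "norm (g (of_real r) / h (of_real r)) \<le> B"
      using circle[of "of_real r"] \<open>0 < r\<close> by simp
    then show "0 \<le> B"
      by (rule order_trans[OF norm_ge_zero])
  qed (use finite circle \<open>h 0 \<noteq> 0\<close> \<open>0 < r\<close> in \<open>auto simp: S_def\<close>)
  then show ?thesis
    by (simp add: S_def fps_nth_fps_expansion[OF expansion])
qed

section \<open>Asymptotics of the renewal function\<close>

lemma renewal_fun_add_nat:
  assumes "0 \<le> s" "s < 1"
  shows "renewal_fun (real n + s)
    = (\<Sum>j\<le>n. exp (real j + s) * (- (real j + s)) ^ (n - j) / fact (n - j))"
proof -
  have "nat \<lfloor>real n + s\<rfloor> = n"
    using assms by linarith
  then have "renewal_fun (real n + s)
      = (\<Sum>k\<le>n. (- 1) ^ k * (real n + s - real k) ^ k * exp (real n + s - real k) / fact k)"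
    by (simp only: renewal_fun_def)
  also have "\<dots>
      = (\<Sum>k\<le>n. exp (real (n - k) + s) * (- (real (n - k) + s)) ^ (n - (n - k)) / fact (n - (n - k)))"
  proof (intro sum.cong refl)
    fix k assume "k \<in> {..n}"
    then have k: "n - (n - k) = k" "real (n - k) + s = real n + s - real k"
      by auto
    show "(- 1) ^ k * (real n + s - real k) ^ k * exp (real n + s - real k) / fact k
        = exp (real (n - k) + s) * (- (real (n - k) + s)) ^ (n - (n - k)) / fact (n - (n - k))"
      unfolding k by (subst (2) power_minus) (simp only: mult_ac)
  qed
  also have "\<dots> = (\<Sum>j\<le>n. exp (real j + s) * (- (real j + s)) ^ (n - j) / fact (n - j))"
    by (rule sum.reindex_bij_witness[of _ "\<lambda>j. n - j" "\<lambda>k. n - k"]) auto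
  finally show ?thesis .
qed

definition renewal_denom :: "complex \<Rightarrow> complex" where
  "renewal_denom z = 1 - z * exp (1 - z)"

definition renewal_gf :: "real \<Rightarrow> complex \<Rightarrow> complex" where
  "renewal_gf s z = exp (of_real s * (1 - z)) / renewal_denom z"

lemma renewal_gf_has_fps_expansion:
  assumes "0 \<le> s" "s < 1"
  shows "renewal_gf s has_fps_expansion Abs_fps (\<lambda>n. of_real (renewal_fun (real n + s)))"
proof -
  define E :: "complex fps" where "E = fps_const (exp 1) * (fps_X * fps_exp (- 1))"
  define B :: "complex fps" where "B = fps_const (exp (of_real s)) * fps_exp (- of_real s)"
  have coeff: "fps_nth (E ^ j * B) n
      = of_real (exp (real j + s) * (- (real j + s)) ^ (n - j) / fact (n - j))"
    if "j \<le> n" for j n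
  proof -
    have "E ^ j * B
        = fps_const (exp (of_real (real j + s))) * (fps_X ^ j * fps_exp (- of_real (real j + s)))"
      by (simp add: E_def B_def power_mult_distrib fps_exp_power_mult exp_add mult_ac fps_const_power
          flip: fps_exp_add_mult fps_const_mult exp_of_nat_mult)
    then show ?thesis
      using that by (simp add: fps_X_power_mult_nth flip: exp_of_real)
  qed
  have E0: "fps_nth E 0 = 0"
    by (simp add: E_def)
  have "Abs_fps (\<lambda>n. of_real (renewal_fun (real n + s))) = B / (1 - E)"
    by (rule fps_ext) (simp add: fps_divide_one_minus_nth[OF E0] renewal_fun_add_nat[OF assms] coeff)
  moreover have "(\<lambda>z. exp (of_real s) * exp (- of_real s * z) / (1 - exp 1 * (z * exp (- 1 * z))))
      has_fps_expansion B / (1 - E)"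
    using E0 unfolding B_def E_def by (intro fps_expansion_intros) auto
  moreover have "(\<lambda>z. exp (of_real s) * exp (- of_real s * z) / (1 - exp 1 * (z * exp (- 1 * z))))
      = renewal_gf s"
    by (simp add: fun_eq_iff renewal_gf_def renewal_denom_def right_diff_distrib mult.left_commute
        flip: exp_add)
  ultimately show ?thesis
    by simp
qed

lemma renewal_denom_eq_0_iff: "renewal_denom z = 0 \<longleftrightarrow> char_root (1 - z)"
proof -
  have "renewal_denom z = exp (1 - z) * ((1 - z) - 1 + exp (- (1 - z)))"
    by (simp add: renewal_denom_def right_diff_distrib distrib_left flip: exp_add)
  then show ?thesis
    by (simp add: char_root_def)
qed

lemma renewal_denom_has_field_derivative:
  "(renewal_denom has_field_derivative (z - 1) * exp (1 - z)) (at z)"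
  unfolding renewal_denom_def by (auto intro!: derivative_eq_intros simp: algebra_simps)

lemma holomorphic_on_renewal_denom: "renewal_denom holomorphic_on A"
  unfolding renewal_denom_def by (intro holomorphic_intros)

lemma residue_renewal_gf_simple_pole:
  assumes "char_root \<rho>" "\<rho> \<noteq> 0"
  shows "residue (\<lambda>z. renewal_gf s z / z ^ Suc n) (1 - \<rho>) = - (exp (\<rho> * of_real (real n + s)) / \<rho>)"
proof -
  have pole: "1 - \<rho> = exp (- \<rho>)"
    using assms(1) by (simp add: char_root_def algebra_simps)
  then have "1 - \<rho> \<noteq> 0"
    by simp
  define f where "f z = exp (of_real s * (1 - z)) / z ^ Suc n" for z :: complex
  have "residue (\<lambda>z. f z / renewal_denom z) (1 - \<rho>) = f (1 - \<rho>) / (- \<rho> * exp \<rho>)"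
  proof (rule residue_simple_pole_deriv[where s = "- {0}"])
    show "f holomorphic_on - {0}"
      unfolding f_def by (auto intro!: holomorphic_intros)
    show "(renewal_denom has_field_derivative - \<rho> * exp \<rho>) (at (1 - \<rho>))"
      using renewal_denom_has_field_derivative[of "1 - \<rho>"] by simp
    show "connected (- {0 :: complex})"
      by (rule connected_punctured_universe) simp
  qed (use assms \<open>1 - \<rho> \<noteq> 0\<close> in \<open>auto simp: f_def renewal_denom_eq_0_iff holomorphic_on_renewal_denom\<close>)
  also have "f (1 - \<rho>) = exp (\<rho> * of_real s) * exp \<rho> ^ Suc n"
    by (simp add: f_def) (simp add: pole exp_minus divide_inverse power_inverse mult.commute)
  also have "exp (\<rho> * of_real s) * exp \<rho> ^ Suc n / (- \<rho> * exp \<rho>)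
      = - (exp (\<rho> * of_real (real n + s)) / \<rho>)"
    by (simp add: exp_add distrib_left mult.commute flip: exp_of_nat_mult)
  finally show ?thesis
    by (simp add: f_def renewal_gf_def mult.commute)
qed

lemma residue_renewal_gf_one:
  "residue (\<lambda>z. renewal_gf s z / z ^ Suc n) 1 = - of_real (2 * (real n + s) + 2 / 3)"
proof -
  define f where "f z = exp (of_real s * (1 - z)) / z ^ Suc n" for z :: complex
  define G :: "complex fps" where "G = 1 - (1 + fps_X) * fps_exp (- 1)"
  have "(\<lambda>w. 1 - (1 + w) * exp (- 1 * w)) has_fps_expansion G"
    unfolding G_def by (intro fps_expansion_intros)
  then have expansion: "(\<lambda>w. renewal_denom (1 + w)) has_fps_expansion G"
    by (simp add: renewal_denom_def)
  have G: "fps_nth G 0 = 0" "fps_nth G 1 = 0" "fps_nth G 2 = 1 / 2" "fps_nth G 3 = - 1 / 3"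
    by (simp_all add: G_def distrib_right eval_nat_numeral)
  have "f analytic_on {1}"
    unfolding f_def by (intro analytic_intros) auto
  moreover have "(f has_field_derivative - of_real s - of_nat (Suc n)) (at 1)"
    unfolding f_def by (auto intro!: derivative_eq_intros simp del: power_Suc of_nat_Suc)
  ultimately have "residue (\<lambda>z. f z / renewal_denom z) 1 = - of_real (2 * (real n + s) + 2 / 3)"
    using residue_divide_double_zero[OF _ expansion] G
    by (simp add: DERIV_imp_deriv f_def[of 1] power2_eq_square algebra_simps)
  then show ?thesis
    by (simp add: f_def renewal_gf_def mult.commute)
qed

definition char_roots_below :: "real \<Rightarrow> complex set" where
  "char_roots_below r = {\<rho>. char_root \<rho> \<and> \<rho> \<noteq> 0 \<and> exp (- Re \<rho>) < r}"

lemma renewal_denom_zeros_ball: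
  assumes "1 < r"
  shows "{p. p \<in> ball 0 r \<and> renewal_denom p = 0} = insert 1 ((\<lambda>\<rho>. 1 - \<rho>) ` char_roots_below r)"
proof (intro equalityI subsetI)
  fix p assume "p \<in> {p. p \<in> ball 0 r \<and> renewal_denom p = 0}"
  then have "char_root (1 - p)" "exp (- Re (1 - p)) < r"
    using char_root_norm[of "1 - p"] by (auto simp: renewal_denom_eq_0_iff)
  then show "p \<in> insert 1 ((\<lambda>\<rho>. 1 - \<rho>) ` char_roots_below r)"
    by (auto simp: char_roots_below_def intro!: image_eqI[of _ _ "1 - p"])
next
  fix p assume "p \<in> insert 1 ((\<lambda>\<rho>. 1 - \<rho>) ` char_roots_below r)"
  moreover have "char_root 0"
    by (simp add: char_root_def)
  ultimately show "p \<in> {p. p \<in> ball 0 r \<and> renewal_denom p = 0}"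
    using assms by (auto simp: char_roots_below_def renewal_denom_eq_0_iff char_root_norm)
qed

lemma finite_char_roots_below: "finite (char_roots_below r)"
proof -
  have "finite {p \<in> cball 0 r. renewal_denom p = 0}"
    by (rule finite_zeros_cball[OF holomorphic_on_renewal_denom, of 0]) (simp add: renewal_denom_def)
  then have "finite ((\<lambda>\<rho>. 1 - \<rho>) ` char_roots_below r)"
    by (rule rev_finite_subset) (auto simp: char_roots_below_def renewal_denom_eq_0_iff char_root_norm)
  then show ?thesis
    by (rule finite_imageD) (auto simp: inj_on_def)
qed

lemma renewal_denom_nonzero_on_circle:
  assumes "\<And>\<rho>. char_root \<rho> \<Longrightarrow> exp (- Re \<rho>) \<noteq> r" "norm z = r"
  shows "renewal_denom z \<noteq> 0"
proof
  assume "renewal_denom z = 0"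
  then have root: "char_root (1 - z)"
    by (simp add: renewal_denom_eq_0_iff)
  then have "exp (- Re (1 - z)) = r"
    using char_root_norm[OF root] assms(2) by simp
  with assms(1)[OF root] show False
    by contradiction
qed

lemma renewal_gf_bounded_on_circle:
  assumes "\<And>\<rho>. char_root \<rho> \<Longrightarrow> exp (- Re \<rho>) \<noteq> r"
  obtains B where "\<And>s z. 0 \<le> s \<Longrightarrow> s \<le> 1 \<Longrightarrow> norm z = r \<Longrightarrow> norm (renewal_gf s z) \<le> B"
proof -
  have "continuous_on ({0..1} \<times> sphere 0 r) (\<lambda>(s, z). renewal_gf s z)"
    using renewal_denom_nonzero_on_circle[OF assms]
    unfolding renewal_gf_def renewal_denom_def case_prod_unfold
    by (intro continuous_intros) (auto simp: dist_norm)
  then have "bounded ((\<lambda>(s, z). renewal_gf s z) ` ({0..1} \<times> sphere 0 r))"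
    by (intro compact_imp_bounded compact_continuous_image compact_Times) auto
  then show thesis
    unfolding bounded_iff using that by fastforce
qed

definition char_root_sum :: "real \<Rightarrow> real \<Rightarrow> complex" where
  "char_root_sum r t = (\<Sum>\<rho>\<in>char_roots_below r. exp (\<rho> * of_real t) / \<rho>)"

lemma renewal_fun_residue_bound:
  fixes n :: nat and s :: real
  assumes "1 < r" and circle: "\<And>\<rho>. char_root \<rho> \<Longrightarrow> exp (- Re \<rho>) \<noteq> r"
    and s: "0 \<le> s" "s < 1" and bound: "\<And>z. norm z = r \<Longrightarrow> norm (renewal_gf s z) \<le> B"
  defines "t \<equiv> real n + s"
  shows "norm (of_real (renewal_fun t - (2 * t + 2 / 3)) - char_root_sum r t) \<le> B / r ^ n"
proof -
  let ?res = "residue (\<lambda>z. renewal_gf s z / z ^ Suc n)"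
  have "norm (fps_nth (Abs_fps (\<lambda>n. of_real (renewal_fun (real n + s)))) n
      + (\<Sum>p | p \<in> ball 0 r \<and> renewal_denom p = 0. ?res p)) \<le> B / r ^ n"
    using bound renewal_gf_has_fps_expansion[OF s] renewal_denom_nonzero_on_circle[OF circle] \<open>1 < r\<close>
    unfolding renewal_gf_def[abs_def]
    by (intro fps_coeff_quotient_bound holomorphic_on_renewal_denom holomorphic_intros)
       (auto simp: renewal_denom_def)
  also have "(\<Sum>p | p \<in> ball 0 r \<and> renewal_denom p = 0. ?res p)
      = ?res 1 + (\<Sum>\<rho>\<in>char_roots_below r. ?res (1 - \<rho>))"
    unfolding renewal_denom_zeros_ball[OF \<open>1 < r\<close>] using finite_char_roots_below
    by (subst sum.insert) (auto simp: char_roots_below_def sum.reindex inj_on_def)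
  also have "\<dots> = - of_real (2 * t + 2 / 3) - char_root_sum r t"
    unfolding residue_renewal_gf_one t_def char_root_sum_def
    by (simp add: residue_renewal_gf_simple_pole char_roots_below_def sum_negf del: power_Suc)
  finally show ?thesis
    by (simp add: t_def algebra_simps)
qed

theorem renewal_fun_expansion:
  assumes "1 < r" and circle: "\<And>\<rho>. char_root \<rho> \<Longrightarrow> exp (- Re \<rho>) \<noteq> r"
  shows "(\<lambda>t. norm (of_real (renewal_fun t - (2 * t + 2 / 3)) - char_root_sum r t))
    \<in> O[at_top](\<lambda>t. r powr (- t))"
proof -
  obtain B where B: "\<And>s z. 0 \<le> s \<Longrightarrow> s \<le> 1 \<Longrightarrow> norm z = r \<Longrightarrow> norm (renewal_gf s z) \<le> B"
    using renewal_gf_bounded_on_circle[OF circle] by blast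
  have "norm (renewal_gf 0 (of_real r)) \<le> B"
    using \<open>1 < r\<close> by (intro B) auto
  then have "0 \<le> B"
    by (rule order_trans[OF norm_ge_zero])
  have "norm (of_real (renewal_fun t - (2 * t + 2 / 3)) - char_root_sum r t) \<le> (B * r) * r powr (- t)"
    if "t \<ge> 0" for t
  proof -
    define n s where "n = nat \<lfloor>t\<rfloor>" and "s = frac t"
    have t: "real n + s = t" "0 \<le> s" "s < 1"
      using \<open>t \<ge> 0\<close> frac_lt_1[of t] by (auto simp: n_def s_def frac_def)
    have "norm (of_real (renewal_fun t - (2 * t + 2 / 3)) - char_root_sum r t) \<le> B / r ^ n"
      using renewal_fun_residue_bound[OF assms t(2,3), of B n] B t by simp
    also have "\<dots> = B * r powr (s - t)"
      using \<open>1 < r\<close> by (simp add: powr_minus_divide powr_realpow flip: t(1))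
    also have "\<dots> \<le> B * r powr (1 - t)"
      using \<open>1 < r\<close> \<open>0 \<le> B\<close> t(3) by (intro mult_left_mono powr_mono) auto
    also have "\<dots> = (B * r) * r powr (- t)"
      using \<open>1 < r\<close> by (simp add: powr_diff powr_minus_divide)
    finally show ?thesis .
  qed
  then show ?thesis
    by (intro bigoI[of _ "B * r"]) (auto intro!: eventually_mono[OF eventually_ge_at_top[of 0]])
qed

lemma char_roots_below_10: "char_roots_below 10 = {dominant_root, cnj dominant_root}"
proof (intro equalityI subsetI)
  fix \<rho> assume "\<rho> \<in> char_roots_below 10"
  then show "\<rho> \<in> {dominant_root, cnj dominant_root}"
    using nonzero_char_root_cases[of \<rho>] pi_gt3 by (auto simp: char_roots_below_def)
next
  fix \<rho> assume "\<rho> \<in> {dominant_root, cnj dominant_root}"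
  then show "\<rho> \<in> char_roots_below 10"
    using dominant_root_enclosure by (auto simp: char_roots_below_def char_root_cnj_iff)
qed

lemma no_char_root_on_circle_10:
  assumes "char_root \<rho>"
  shows "exp (- Re \<rho>) \<noteq> 10"
proof
  assume eq: "exp (- Re \<rho>) = 10"
  then have "\<rho> \<noteq> 0"
    by auto
  with assms eq pi_gt3 have "\<rho> = dominant_root \<or> \<rho> = cnj dominant_root"
    by (intro nonzero_char_root_cases) auto
  with eq exp_minus_Re_dominant_root show False
    by auto
qed

lemma char_root_sum_10_bigo: "(\<lambda>t. norm (char_root_sum 10 t)) \<in> O[at_top](\<lambda>t. exp (alpha1 * t))"
proof (rule bigoI[OF always_eventually], intro allI)
  fix t
  have "norm (char_root_sum 10 t) \<le> (\<Sum>\<rho>\<in>char_roots_below 10. norm (exp (\<rho> * of_real t) / \<rho>))"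
    unfolding char_root_sum_def by (rule norm_sum)
  also have "\<dots> = (\<Sum>\<rho>\<in>char_roots_below 10. 1 / norm \<rho>) * exp (alpha1 * t)"
    unfolding sum_distrib_right
    by (intro sum.cong) (auto simp: char_roots_below_10 alpha1_eq_Re_dominant_root norm_divide)
  finally show "norm (norm (char_root_sum 10 t))
      \<le> (\<Sum>\<rho>\<in>char_roots_below 10. 1 / norm \<rho>) * norm (exp (alpha1 * t))"
    by simp
qed

lemma powr_minus_in_bigo_exp:
  fixes r a :: real
  assumes "0 < r" "- ln r \<le> a"
  shows "(\<lambda>t. r powr (- t)) \<in> O[at_top](\<lambda>t. exp (a * t))"
proof (rule bigoI[where c = 1])
  show "\<forall>\<^sub>F t in at_top. norm (r powr (- t)) \<le> 1 * norm (exp (a * t))"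
    using eventually_ge_at_top[of 0]
  proof eventually_elim
    case (elim t)
    with assms(2) have "- ln r * t \<le> a * t"
      by (rule mult_right_mono)
    with assms(1) show ?case
      by (simp add: powr_def mult.commute)
  qed
qed

theorem renewal_fun_asymptotics:
  "(\<lambda>t. renewal_fun t - (2 * t + 2 / 3)) \<in> O[at_top](\<lambda>t. exp (alpha1 * t))"
proof -
  let ?d = "\<lambda>t. complex_of_real (renewal_fun t - (2 * t + 2 / 3))"
  have "exp (- alpha1) < 10"
    by (simp add: alpha1_eq_Re_dominant_root exp_minus_Re_dominant_root)
  then have "- ln 10 \<le> alpha1"
    using ln_less_cancel_iff[of "exp (- alpha1)" 10] by simp
  have "(\<lambda>t. norm (?d t - char_root_sum 10 t)) \<in> O[at_top](\<lambda>t. 10 powr (- t))"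
    by (intro renewal_fun_expansion no_char_root_on_circle_10) auto
  also have "(\<lambda>t. 10 powr (- t)) \<in> O[at_top](\<lambda>t. exp (alpha1 * t))"
    by (rule powr_minus_in_bigo_exp) (simp, fact)
  finally have "(\<lambda>t. norm (?d t - char_root_sum 10 t) + norm (char_root_sum 10 t))
      \<in> O[at_top](\<lambda>t. exp (alpha1 * t))"
    by (intro sum_in_bigo char_root_sum_10_bigo)
  moreover have "(\<lambda>t. renewal_fun t - (2 * t + 2 / 3))
      \<in> O[at_top](\<lambda>t. norm (?d t - char_root_sum 10 t) + norm (char_root_sum 10 t))"
  proof (rule bigoI[OF always_eventually, where c = 1], intro allI)
    fix t
    have "norm (renewal_fun t - (2 * t + 2 / 3)) = norm (?d t)"
      by (simp only: norm_of_real real_norm_def)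
    also have "\<dots> \<le> norm (?d t - char_root_sum 10 t) + norm (char_root_sum 10 t)"
      by (metis diff_add_cancel norm_triangle_ineq)
    finally show "norm (renewal_fun t - (2 * t + 2 / 3))
        \<le> 1 * norm (norm (?d t - char_root_sum 10 t) + norm (char_root_sum 10 t))"
      by simp
  qed
  ultimately show ?thesis
    by (rule landau_o.big_trans[rotated])
qed

section \<open>Moments of the counting function\<close>

lemma nn_integral_sum_lessThan:
  fixes w :: "nat \<Rightarrow> ennreal"
  assumes [measurable]: "N \<in> measurable M (count_space UNIV)"
  shows "(\<integral>\<^sup>+\<omega>. (\<Sum>n<N \<omega>. w n) \<partial>M) = (\<Sum>n. w n * emeasure M {\<omega> \<in> space M. n < N \<omega>})"
proof -
  have "(\<Sum>n<N \<omega>. w n) = (\<Sum>n. w n * indicator {\<omega> \<in> space M. n < N \<omega>} \<omega>)" if "\<omega> \<in> space M" for \<omega>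
  proof -
    have "(\<Sum>n. w n * indicator {\<omega> \<in> space M. n < N \<omega>} \<omega>)
        = (\<Sum>n<N \<omega>. w n * indicator {\<omega> \<in> space M. n < N \<omega>} \<omega>)"
      by (rule suminf_finite) auto
    then show ?thesis
      using that by simp
  qed
  then have "(\<integral>\<^sup>+\<omega>. (\<Sum>n<N \<omega>. w n) \<partial>M) = (\<integral>\<^sup>+\<omega>. (\<Sum>n. w n * indicator {\<omega> \<in> space M. n < N \<omega>} \<omega>) \<partial>M)"
    by (intro nn_integral_cong)
  also have "\<dots> = (\<Sum>n. \<integral>\<^sup>+\<omega>. w n * indicator {\<omega> \<in> space M. n < N \<omega>} \<omega> \<partial>M)"
    by (rule nn_integral_suminf) measurable
  finally show ?thesis
    by (simp add: nn_integral_cmult_indicator)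
qed

lemma (in finite_measure) has_bochner_integral_sum_lessThan:
  fixes w :: "nat \<Rightarrow> real"
  assumes N [measurable]: "N \<in> measurable M (count_space UNIV)"
    and w: "\<And>n. 0 \<le> w n" and tail: "(\<lambda>n. w n * \<P>(\<omega> in M. n < N \<omega>)) sums s"
  shows "has_bochner_integral M (\<lambda>\<omega>. \<Sum>n<N \<omega>. w n) s"
proof (rule has_bochner_integral_nn_integral)
  show "0 \<le> s"
    using tail w by (intro sums_le[OF _ sums_zero tail]) simp
  have "(\<integral>\<^sup>+\<omega>. ennreal (\<Sum>n<N \<omega>. w n) \<partial>M) = (\<integral>\<^sup>+\<omega>. (\<Sum>n<N \<omega>. ennreal (w n)) \<partial>M)"
    using w by (simp add: sum_ennreal)
  also have "\<dots> = (\<Sum>n. ennreal (w n) * emeasure M {\<omega> \<in> space M. n < N \<omega>})"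
    by (rule nn_integral_sum_lessThan[OF N])
  also have "\<dots> = (\<Sum>n. ennreal (w n * \<P>(\<omega> in M. n < N \<omega>)))"
    using w by (simp add: emeasure_eq_measure ennreal_mult)
  also have "\<dots> = ennreal s"
    using w tail by (intro suminf_ennreal_eq) auto
  finally show "(\<integral>\<^sup>+\<omega>. ennreal (\<Sum>n<N \<omega>. w n) \<partial>M) = ennreal s" .
qed (use w in \<open>auto intro: sum_nonneg\<close>)

lemma (in prob_space) prob_uniform_add_le_has_integral:
  fixes X S :: "'a \<Rightarrow> real"
  assumes indep: "indep_var borel X borel S"
    and uniform: "distr M borel X = uniform_measure lborel {0<..<1}"
  shows "((\<lambda>x. \<P>(\<omega> in M. S \<omega> \<le> t - x)) has_integral \<P>(\<omega> in M. X \<omega> + S \<omega> \<le> t)) {0..1}"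
proof -
  have [measurable]: "random_variable borel X" "random_variable borel S"
    using indep by (auto dest: indep_var_rv1 indep_var_rv2)
  have "mono (\<lambda>y. \<P>(\<omega> in M. S \<omega> \<le> y))"
    by (intro monoI finite_measure_mono) auto
  then have [measurable]: "(\<lambda>y. \<P>(\<omega> in M. S \<omega> \<le> y)) \<in> borel_measurable borel"
    by (rule borel_measurable_mono)
  have "ennreal (\<P>(\<omega> in M. X \<omega> + S \<omega> \<le> t)) = emeasure (distr M borel (\<lambda>\<omega>. X \<omega> + S \<omega>)) {..t}"
    by (subst emeasure_distr) (auto simp: emeasure_eq_measure intro!: arg_cong[where f = prob])
  also have "\<dots> = emeasure (convolution (distr M borel X) (distr M borel S)) {..t}"
    using indep by (simp add: sum_indep_random_variable)
  also have "\<dots> = (\<integral>\<^sup>+x. emeasure (distr M borel S) {y. y + x \<in> {..t}} \<partial>distr M borel X)"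
    by (rule convolution_emeasure) (auto intro!: finite_measure_distr)
  also have "\<dots> = (\<integral>\<^sup>+x. ennreal (\<P>(\<omega> in M. S \<omega> \<le> t - x)) \<partial>uniform_measure lborel {0<..<1})"
  proof (subst uniform, intro nn_integral_cong)
    fix x
    show "emeasure (distr M borel S) {y. y + x \<in> {..t}} = ennreal (\<P>(\<omega> in M. S \<omega> \<le> t - x))"
      by (subst emeasure_distr)
         (auto simp: emeasure_eq_measure algebra_simps intro!: arg_cong[where f = prob])
  qed
  also have "\<dots> = (\<integral>\<^sup>+x. ennreal (\<P>(\<omega> in M. S \<omega> \<le> t - x)) * indicator {0<..<1} x \<partial>lborel)"
    by (subst nn_integral_uniform_measure) (auto simp: divide_ennreal_def)
  also have "\<dots> = (\<integral>\<^sup>+x. ennreal (if x \<in> {0<..<1} then \<P>(\<omega> in M. S \<omega> \<le> t - x) else 0) \<partial>lborel)"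
    by (intro nn_integral_cong) (auto simp: indicator_def)
  finally have "((\<lambda>x. if x \<in> {0<..<1} then \<P>(\<omega> in M. S \<omega> \<le> t - x) else 0)
      has_integral \<P>(\<omega> in M. X \<omega> + S \<omega> \<le> t)) UNIV"
    by (intro nn_integral_has_integral) auto
  then show ?thesis
    by (simp only: has_integral_restrict_UNIV has_integral_Icc_iff_Ioo)
qed

locale uniform_renewal = prob_space M for M :: "'a measure" +
  fixes X :: "nat \<Rightarrow> 'a \<Rightarrow> real"
  assumes indep_increments: "indep_vars (\<lambda>_. borel) X {1..}"
    and uniform_increments: "\<And>i. i \<ge> 1 \<Longrightarrow> distr M borel (X i) = uniform_measure lborel {0<..<1}"
begin

lemma increment_measurable [measurable (raw)]: "i \<ge> 1 \<Longrightarrow> random_variable borel (X i)"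
  using indep_increments unfolding indep_vars_def2 by auto

lemma renewal_sum_measurable [measurable]: "random_variable borel (renewal_sum X n)"
  unfolding renewal_sum_def by (intro borel_measurable_sum increment_measurable) auto

lemma renewal_count_measurable [measurable]: "renewal_count X t \<in> measurable M (count_space UNIV)"
  unfolding renewal_count_def by measurable

lemma prob_renewal_sum_le: "\<P>(\<omega> in M. renewal_sum X n \<omega> \<le> t) = irwin_hall n t"
proof (induction n arbitrary: t)
  case 0
  show ?case
    by (auto simp: renewal_sum_def irwin_hall_def trunc_power_def prob_space)
next
  case (Suc n)
  have "indep_vars (\<lambda>_. borel) X (insert (Suc n) {1..n})"
    by (rule indep_vars_subset[OF indep_increments]) auto
  then have "indep_var borel (X (Suc n)) borel (renewal_sum X n)"
    unfolding renewal_sum_def[abs_def] by (intro indep_vars_sum) auto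
  then have "((\<lambda>x. \<P>(\<omega> in M. renewal_sum X n \<omega> \<le> t - x))
      has_integral \<P>(\<omega> in M. X (Suc n) \<omega> + renewal_sum X n \<omega> \<le> t)) {0..1}"
    by (rule prob_uniform_add_le_has_integral) (simp add: uniform_increments)
  moreover have "X (Suc n) \<omega> + renewal_sum X n \<omega> = renewal_sum X (Suc n) \<omega>" for \<omega>
    by (simp add: renewal_sum_def)
  ultimately have "((\<lambda>x. irwin_hall n (t - x))
      has_integral \<P>(\<omega> in M. renewal_sum X (Suc n) \<omega> \<le> t)) {0..1}"
    by (simp only: Suc.IH)
  then show ?case
    by (rule has_integral_unique[OF _ irwin_hall_has_integral])
qed

lemma AE_increments_pos: "AE \<omega> in M. \<forall>i\<ge>1. X i \<omega> > 0"
proof (subst AE_all_countable, intro allI)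
  fix i
  show "AE \<omega> in M. 1 \<le> i \<longrightarrow> X i \<omega> > 0"
  proof (cases "1 \<le> i")
    case True
    have "AE x in uniform_measure lborel {0<..<1::real}. x > 0"
      by (rule AE_uniform_measureI) auto
    then have "AE x in distr M borel (X i). x > 0"
      by (simp only: uniform_increments[OF True])
    then show ?thesis
      using increment_measurable[OF True] by (subst (asm) AE_distr_iff) auto
  qed auto
qed

lemma AE_renewal_sum_exceeds:
  assumes "t \<ge> 0"
  shows "AE \<omega> in M. \<exists>n. renewal_sum X n \<omega> > t"
proof -
  have "(\<lambda>n. irwin_hall n t) \<longlonglongrightarrow> 0"
    using irwin_hall_sums[OF assms] by (intro summable_LIMSEQ_zero) (simp add: sums_iff)
  moreover have "\<P>(\<omega> in M. \<forall>n. renewal_sum X n \<omega> \<le> t) \<le> irwin_hall n t" for n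
    unfolding prob_renewal_sum_le[symmetric] by (rule finite_measure_mono) auto
  ultimately have "\<P>(\<omega> in M. \<forall>n. renewal_sum X n \<omega> \<le> t) \<le> 0"
    by (intro tendsto_lowerbound[where F = sequentially]) auto
  then have "\<P>(\<omega> in M. \<forall>n. renewal_sum X n \<omega> \<le> t) = 0"
    by (simp add: measure_le_0_iff)
  then have "AE \<omega> in M. \<not> (\<forall>n. renewal_sum X n \<omega> \<le> t)"
    by (subst (asm) prob_eq_0) auto
  then show ?thesis
    by (simp add: not_le)
qed

lemma AE_less_renewal_count_iff:
  assumes "t \<ge> 0"
  shows "AE \<omega> in M. \<forall>n. n < renewal_count X t \<omega> \<longleftrightarrow> renewal_sum X n \<omega> \<le> t"
  using AE_increments_pos AE_renewal_sum_exceeds[OF assms]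
proof eventually_elim
  case (elim \<omega>)
  have mono: "renewal_sum X m \<omega> \<le> renewal_sum X n \<omega>" if "m \<le> n" for m n
    unfolding renewal_sum_def using elim(1) that by (intro sum_mono2) (auto intro: less_imp_le)
  have "renewal_sum X (renewal_count X t \<omega>) \<omega> > t"
    unfolding renewal_count_def using elim(2) by (rule LeastI_ex)
  moreover have "renewal_sum X n \<omega> \<le> t" if "n < renewal_count X t \<omega>" for n
    using not_less_Least[OF that[unfolded renewal_count_def]] by simp
  ultimately show ?case
    using mono by (meson leD le_less_trans not_le)
qed

lemma prob_less_renewal_count:
  assumes "t \<ge> 0"
  shows "\<P>(\<omega> in M. n < renewal_count X t \<omega>) = irwin_hall n t"
  unfolding prob_renewal_sum_le[symmetric]
  using AE_less_renewal_count_iff[OF assms] by (intro finite_measure_eq_AE) auto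

lemma has_bochner_integral_renewal_count:
  assumes "t \<ge> 0"
  shows "has_bochner_integral M (\<lambda>\<omega>. real (renewal_count X t \<omega>)) (renewal_fun t)"
  using has_bochner_integral_sum_lessThan[OF renewal_count_measurable, of "\<lambda>_. 1" t "renewal_fun t"]
    irwin_hall_sums[OF assms] by (simp add: prob_less_renewal_count[OF assms])

lemma has_bochner_integral_renewal_count_square:
  assumes "t \<ge> 0"
  shows "has_bochner_integral M (\<lambda>\<omega>. (real (renewal_count X t \<omega>))\<^sup>2) ((2 * t + 1) * renewal_fun t)"
proof -
  have odd_sum: "(\<Sum>n<N. 2 * real n + 1) = (real N)\<^sup>2" for N
    by (induction N) (auto simp: power2_eq_square algebra_simps)
  have "(\<lambda>n. 2 * (real n * irwin_hall n t) + irwin_hall n t)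
      sums (2 * (t * renewal_fun t) + renewal_fun t)"
    by (intro sums_add sums_mult irwin_hall_sums irwin_hall_sums_times assms)
  then have "(\<lambda>n. (2 * real n + 1) * \<P>(\<omega> in M. n < renewal_count X t \<omega>))
      sums ((2 * t + 1) * renewal_fun t)"
    by (simp add: prob_less_renewal_count[OF assms] algebra_simps)
  from has_bochner_integral_sum_lessThan[OF renewal_count_measurable _ this] show ?thesis
    by (simp add: odd_sum)
qed

lemma expectation_renewal_count_square:
  assumes "t \<ge> 0"
  shows "expectation (\<lambda>\<omega>. (real (renewal_count X t \<omega>))\<^sup>2) = (2 * t + 1) * renewal_fun t"
  using has_bochner_integral_renewal_count_square[OF assms] by (rule has_bochner_integral_integral_eq)

lemma variance_renewal_count:
  assumes "t \<ge> 0"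
  shows "variance (\<lambda>\<omega>. real (renewal_count X t \<omega>)) = (2 * t + 1 - renewal_fun t) * renewal_fun t"
  using has_bochner_integral_renewal_count[OF assms] has_bochner_integral_renewal_count_square[OF assms]
  by (subst variance_eq) (auto simp: has_bochner_integral_iff power2_eq_square algebra_simps)

theorem second_moment_asymptotics:
  "(\<lambda>t. expectation (\<lambda>\<omega>. (real (renewal_count X t \<omega>))\<^sup>2) - (4 * t\<^sup>2 + 10 / 3 * t + 2 / 3))
    \<in> O[at_top](\<lambda>t. t * exp (alpha1 * t))"
proof -
  have "(\<lambda>t. (2 * t + 1) * (renewal_fun t - (2 * t + 2 / 3))) \<in> O[at_top](\<lambda>t. t * exp (alpha1 * t))"
    by (intro landau_o.big.mult renewal_fun_asymptotics) real_asymp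
  also have "?this \<longleftrightarrow> ?thesis"
  proof (intro landau_o.big.in_cong)
    show "\<forall>\<^sub>F t in at_top. (2 * t + 1) * (renewal_fun t - (2 * t + 2 / 3))
        = expectation (\<lambda>\<omega>. (real (renewal_count X t \<omega>))\<^sup>2) - (4 * t\<^sup>2 + 10 / 3 * t + 2 / 3)"
      using eventually_ge_at_top[of 0]
      by eventually_elim
         (subst expectation_renewal_count_square, simp_all add: power2_eq_square algebra_simps)
  qed
  finally show ?thesis .
qed

theorem variance_asymptotics:
  "(\<lambda>t. variance (\<lambda>\<omega>. real (renewal_count X t \<omega>)) - (2 / 3 * t + 2 / 9))
    \<in> O[at_top](\<lambda>t. t * exp (alpha1 * t))"
proof -
  define e where "e t = renewal_fun t - (2 * t + 2 / 3)" for t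
  have e: "e \<in> O[at_top](\<lambda>t. exp (alpha1 * t))"
    using renewal_fun_asymptotics by (simp add: e_def[abs_def])
  have "alpha1 < 0"
    using Re_dominant_root by (simp add: alpha1_eq_Re_dominant_root)
  then have "(\<lambda>t. exp (alpha1 * t)) \<in> O[at_top](\<lambda>t. t)"
    by real_asymp
  with e have "e \<in> O[at_top](\<lambda>t. t)"
    by (rule landau_o.big_trans)
  moreover have "(\<lambda>t::real. 2 * t + 1 / 3) \<in> O[at_top](\<lambda>t. t)"
    by real_asymp
  ultimately have "(\<lambda>t. (2 * t + 1 / 3) + e t) \<in> O[at_top](\<lambda>t. t)"
    by (rule sum_in_bigo(1)[rotated])
  then have "(\<lambda>t. ((2 * t + 1 / 3) + e t) * - e t) \<in> O[at_top](\<lambda>t. t * exp (alpha1 * t))"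
    using e by (intro landau_o.big.mult) simp_all
  also have "?this \<longleftrightarrow> ?thesis"
  proof (intro landau_o.big.in_cong)
    show "\<forall>\<^sub>F t in at_top. ((2 * t + 1 / 3) + e t) * - e t
        = variance (\<lambda>\<omega>. real (renewal_count X t \<omega>)) - (2 / 3 * t + 2 / 9)"
      using eventually_ge_at_top[of 0]
      by eventually_elim (simp add: variance_renewal_count e_def algebra_simps)
  qed
  finally show ?thesis .
qed

end

theorem corollary6p5:
  fixes M :: "'a measure" and X :: "nat \<Rightarrow> 'a \<Rightarrow> real"
  assumes "prob_space M"
    and "prob_space.indep_vars M (\<lambda>_. borel) X {1..}"
    and "\<And>i. i \<ge> 1 \<Longrightarrow> distr M borel (X i) = uniform_measure lborel {0<..<1}"
  shows "(\<exists>\<beta>1. char_root (Complex alpha1 \<beta>1) \<and>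
            2.088843 \<le> - alpha1 \<and> - alpha1 < 2.088844 \<and>
            7.461489 \<le> \<beta>1 \<and> \<beta>1 < 7.461490) \<and>
         (\<lambda>t. prob_space.expectation M (\<lambda>\<omega>. (real (renewal_count X t \<omega>))\<^sup>2)
               - (4 * t\<^sup>2 + 10 / 3 * t + 2 / 3))
           \<in> O[at_top](\<lambda>t. t * exp (alpha1 * t)) \<and>
         (\<lambda>t. prob_space.variance M (\<lambda>\<omega>. real (renewal_count X t \<omega>))
               - (2 / 3 * t + 2 / 9))
           \<in> O[at_top](\<lambda>t. t * exp (alpha1 * t))"
proof -
  interpret uniform_renewal M X
    using assms by (intro uniform_renewal.intro uniform_renewal_axioms.intro)
  have "char_root (Complex alpha1 (Im dominant_root))"
    by (simp add: alpha1_eq_Re_dominant_root char_root_dominant_root)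
  moreover have "2.088843 \<le> - alpha1" "- alpha1 < 2.088844"
    unfolding alpha1_eq_Re_dominant_root by (rule Re_dominant_root)+
  ultimately show ?thesis
    using Im_dominant_root second_moment_asymptotics variance_asymptotics by blast
qed

end
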